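(* Assume (H$_1$)–(H$_3$) (listed in the context). Let $d\ge2$ and let $(\overline\rho,\overline{\boldsymbol u},\overline\theta,\overline\eta)\in\mathbb{R}^{d+3}$ be a constant state with $\overline\rho,\overline\theta,\overline\eta>0$ and $\overline\eta=\overline\theta^4$. Then the system $$\overline A^0V_t+\sum_{j=1}^d\overline A^jV_{x_j}+\overline LV=\sum_{j,k=1}^d\overline B^{jk}V_{x_jx_k},$$ with the constant matrices given in the context, is not genuinely coupled; that is, there exist $\omega\in\mathbb{S}^{d-1}$, $\psi\in\mathbb{R}^{d+3}$ with $\psi\ne0$, and $\mu\in\mathbb{R}$ such that, with $A(\omega)=\sum_j\omega_j\overline A^j$ and $B(\omega)=\sum_{j,k}\omega_j\omega_k\overline B^{jk}$, $$B(\omega)\psi=\overline L\psi=0\qquad\text{and}\qquad\mu\overline A^0\psi+A(\omega)\psi=0 .$$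
   Context: Genuine coupling condition: for any $\psi\ne0$ with $B(\omega)\psi=\overline L\psi=0$ for some $\omega\in\mathbb{S}^{d-1}$, there holds $\mu\overline A^0\psi+A(\omega)\psi\neq0$ for every $\mu\in\mathbb{R}$. A bar over a thermodynamic function denotes evaluation at $(\overline\rho,\overline\theta)$; $\hat e_j$ is the $j$-th canonical row vector of $\mathbb{R}^{1\times d}$; $I_d$ is the $d\times d$ identity; block sizes are $1,d,1,1$. The matrices are $$\overline A^0=\mathrm{diag}\big(\overline\theta\,\overline p_\rho\overline\eta/\overline\rho,\ \overline\rho\,\overline\theta\,\overline\eta I_d,\ \overline\rho\,\overline e_\theta\overline\eta,\ \overline\theta/4\big),$$ $$\overline A^j=\begin{pmatrix}\overline\theta\,\overline p_\rho\overline\eta(\overline{\boldsymbol u}\cdot\hat e_j)/\overline\rho&\overline\theta\,\overline p_\rho\overline\eta\,\hat e_j&0&0\\ \overline\theta\,\overline p_\rho\overline\eta\,\hat e_j^\top&\overline\rho\,\overline\theta\,\overline\eta(\overline{\boldsymbol u}\cdot\hat e_j)I_d&\overline\theta\,\overline\eta\,\overline p_\theta\hat e_j^\top&\tfrac13\overline\theta\,\overline\eta\,\hat e_j^\top\\0&\overline\theta\,\overline\eta\,\overline p_\theta\hat e_j&\overline\rho\,\overline e_\theta\overline\eta(\overline{\boldsymbol u}\cdot\hat e_j)&0\\0&\tfrac13\overline\theta\,\overline\eta\,\hat e_j&0&\overline\theta(\overline{\boldsymbol u}\cdot\hat e_j)/4\end{pmatrix};$$ $\overline L$ vanishes except for its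 lower-right $2\times2$ block $\begin{pmatrix}4\sigma_a\overline\theta^3\overline\eta&-\sigma_a\overline\theta^4\\-\sigma_a\overline\theta^4&\sigma_a\overline\theta/4\end{pmatrix}$; $\overline B^{jk}$ vanishes except for its last diagonal entry $\delta_{jk}\overline\theta/(12\sigma_s)$. This is the symmetrized linearization of the $d$-dimensional non-equilibrium radiation hydrodynamics system around the equilibrium state, in the variables $V=(\rho,\boldsymbol u,\theta,\eta)$. Assumptions: (H$_1$) the independent thermodynamic variables $(\rho,\theta)$ take values in $\mathcal D=\{\rho>0,\theta>0\}$. (H$_2$) the pressure $p$, internal energy $e$ and specific entropy $s$ of the fluid are $C^\infty$ functions on $\mathcal D$ with $p>0$, $p_\rho>0$, $p_\theta>0$, $e_\theta>0$, satisfying $de=\theta\,ds-p\,d(1/\rho)$. (H$_3$) $\sigma_a,\sigma_s$ are positive constants. *)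

theory Defs
  imports "HOL-Analysis.Analysis"
begin

section \<open>Index set of the unknowns\<close>

text \<open>The state vector \<open>V = (\<rho>, u, \<theta>, \<eta>)\<close> has blocks of sizes \<open>1, d, 1, 1\<close>. The space
  \<open>\<real>\<^sup>d\<close> is \<open>real ^ 'n\<close> with \<open>d = CARD('n)\<close>, and \<open>\<real>\<^sup>d\<^sup>+\<^sup>3\<close> is \<open>real ^ 'n comp\<close>.\<close>

datatype 'n comp = Rho | Vel 'n | Theta | Eta

lemma UNIV_comp: "UNIV = insert Rho (insert Theta (insert Eta (range Vel)))"
  by (auto intro: comp.exhaust)

instance comp :: (finite) finite
  by standard (simp add: UNIV_comp)

lemma card_comp: "CARD('n::finite comp) = CARD('n) + 3"
proof -
  have "card (range (Vel :: 'n \<Rightarrow> 'n comp)) = CARD('n)"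
    by (rule card_image) (simp add: inj_on_def)
  then show ?thesis
    by (simp add: UNIV_comp card_insert_if image_iff)
qed


section \<open>Thermodynamics\<close>

text \<open>Thermodynamic functions are functions of the pair \<open>(\<rho>, \<theta>)\<close>.\<close>

definition thermo_domain :: "(real \<times> real) set" where
  "thermo_domain = {(\<rho>, \<theta>). \<rho> > 0 \<and> \<theta> > 0}"

definition d_rho :: "(real \<times> real \<Rightarrow> real) \<Rightarrow> real \<times> real \<Rightarrow> real" where
  "d_rho f = (\<lambda>(\<rho>, \<theta>). deriv (\<lambda>r. f (r, \<theta>)) \<rho>)"

definition d_theta :: "(real \<times> real \<Rightarrow> real) \<Rightarrow> real \<times> real \<Rightarrow> real" where
  "d_theta f = (\<lambda>(\<rho>, \<theta>). deriv (\<lambda>t. f (\<rho>, t)) \<theta>)"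

text \<open>\<open>Ck_on k f S\<close>: \<open>f\<close> is of class \<open>C\<^sup>k\<close> on the open set \<open>S\<close>. A differentiable \<open>f\<close> is of class
  \<open>C\<^sup>k\<^sup>+\<^sup>1\<close> if and only if all its directional derivatives are of class \<open>C\<^sup>k\<close>.\<close>

primrec Ck_on :: "nat \<Rightarrow> ('a::euclidean_space \<Rightarrow> real) \<Rightarrow> 'a set \<Rightarrow> bool" where
  "Ck_on 0 f S \<longleftrightarrow> continuous_on S f"
| "Ck_on (Suc k) f S \<longleftrightarrow>
     (\<forall>x\<in>S. f differentiable (at x)) \<and> (\<forall>v. Ck_on k (\<lambda>x. frechet_derivative f (at x) v) S)"

definition smooth_on :: "('a::euclidean_space \<Rightarrow> real) \<Rightarrow> 'a set \<Rightarrow> bool" where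
  "smooth_on f S \<longleftrightarrow> (\<forall>k. Ck_on k f S)"

text \<open>The relation \<open>de = \<theta> ds - p d(1/\<rho>)\<close>, as an identity between the differentials at each point
  of the domain; \<open>h\<close> is the tangent vector.\<close>

definition gibbs_relation ::
  "(real \<times> real \<Rightarrow> real) \<Rightarrow> (real \<times> real \<Rightarrow> real) \<Rightarrow> (real \<times> real \<Rightarrow> real) \<Rightarrow> bool" where
  "gibbs_relation p e s \<longleftrightarrow>
     (\<forall>(\<rho>, \<theta>)\<in>thermo_domain. \<forall>h.
        frechet_derivative e (at (\<rho>, \<theta>)) h
          = \<theta> * frechet_derivative s (at (\<rho>, \<theta>)) h
            - p (\<rho>, \<theta>) * frechet_derivative (\<lambda>(r, t). 1 / r) (at (\<rho>, \<theta>)) h)"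

definition thermo_functions ::
  "(real \<times> real \<Rightarrow> real) \<Rightarrow> (real \<times> real \<Rightarrow> real) \<Rightarrow> (real \<times> real \<Rightarrow> real) \<Rightarrow> bool" where
  "thermo_functions p e s \<longleftrightarrow>
     smooth_on p thermo_domain \<and> smooth_on e thermo_domain \<and> smooth_on s thermo_domain \<and>
     (\<forall>x\<in>thermo_domain. p x > 0 \<and> d_rho p x > 0 \<and> d_theta p x > 0 \<and> d_theta e x > 0) \<and>
     gibbs_relation p e s"


section \<open>Coefficient matrices of the linearized system\<close>

text \<open>In these definitions \<open>(\<rho>, u, \<theta>, \<eta>)\<close> is the constant state around which the system is
  linearized. In \<open>M $ a $ b\<close> the row index is \<open>a\<close>, and \<open>axis j 1\<close> is the unit vector \<open>e\<^sub>j\<close>.\<close>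

definition matA0 ::
  "(real \<times> real \<Rightarrow> real) \<Rightarrow> (real \<times> real \<Rightarrow> real) \<Rightarrow> real \<Rightarrow> real \<Rightarrow> real
    \<Rightarrow> real ^ ('n::finite comp) ^ ('n comp)" where
  "matA0 p e \<rho> \<theta> \<eta> = (\<chi> a b. case (a, b) of
       (Rho, Rho) \<Rightarrow> \<theta> * d_rho p (\<rho>, \<theta>) * \<eta> / \<rho>
     | (Vel i, Vel k) \<Rightarrow> \<rho> * \<theta> * \<eta> * (if i = k then 1 else 0)
     | (Theta, Theta) \<Rightarrow> \<rho> * d_theta e (\<rho>, \<theta>) * \<eta>
     | (Eta, Eta) \<Rightarrow> \<theta> / 4
     | _ \<Rightarrow> 0)"

definition matA ::
  "(real \<times> real \<Rightarrow> real) \<Rightarrow> (real \<times> real \<Rightarrow> real) \<Rightarrow> real \<Rightarrow> real ^ 'n::finite \<Rightarrow> real \<Rightarrow> real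
    \<Rightarrow> 'n \<Rightarrow> real ^ ('n comp) ^ ('n comp)" where
  "matA p e \<rho> u \<theta> \<eta> j = (\<chi> a b. case (a, b) of
       (Rho, Rho) \<Rightarrow> \<theta> * d_rho p (\<rho>, \<theta>) * \<eta> * (u \<bullet> axis j 1) / \<rho>
     | (Rho, Vel k) \<Rightarrow> \<theta> * d_rho p (\<rho>, \<theta>) * \<eta> * axis j 1 $ k
     | (Vel i, Rho) \<Rightarrow> \<theta> * d_rho p (\<rho>, \<theta>) * \<eta> * axis j 1 $ i
     | (Vel i, Vel k) \<Rightarrow> \<rho> * \<theta> * \<eta> * (u \<bullet> axis j 1) * (if i = k then 1 else 0)
     | (Vel i, Theta) \<Rightarrow> \<theta> * \<eta> * d_theta p (\<rho>, \<theta>) * axis j 1 $ i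
     | (Vel i, Eta) \<Rightarrow> 1 / 3 * \<theta> * \<eta> * axis j 1 $ i
     | (Theta, Vel k) \<Rightarrow> \<theta> * \<eta> * d_theta p (\<rho>, \<theta>) * axis j 1 $ k
     | (Theta, Theta) \<Rightarrow> \<rho> * d_theta e (\<rho>, \<theta>) * \<eta> * (u \<bullet> axis j 1)
     | (Eta, Vel k) \<Rightarrow> 1 / 3 * \<theta> * \<eta> * axis j 1 $ k
     | (Eta, Eta) \<Rightarrow> \<theta> * (u \<bullet> axis j 1) / 4
     | _ \<Rightarrow> 0)"

definition matL :: "real \<Rightarrow> real \<Rightarrow> real \<Rightarrow> real ^ ('n::finite comp) ^ ('n comp)" where
  "matL \<sigma>a \<theta> \<eta> = (\<chi> a b. case (a, b) of
       (Theta, Theta) \<Rightarrow> 4 * \<sigma>a * \<theta> ^ 3 * \<eta>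
     | (Theta, Eta) \<Rightarrow> - \<sigma>a * \<theta> ^ 4
     | (Eta, Theta) \<Rightarrow> - \<sigma>a * \<theta> ^ 4
     | (Eta, Eta) \<Rightarrow> \<sigma>a * \<theta> / 4
     | _ \<Rightarrow> 0)"

definition matB :: "real \<Rightarrow> real \<Rightarrow> 'n \<Rightarrow> 'n \<Rightarrow> real ^ ('n::finite comp) ^ ('n comp)" where
  "matB \<sigma>s \<theta> j k = (\<chi> a b. case (a, b) of
       (Eta, Eta) \<Rightarrow> (if j = k then 1 else 0) * \<theta> / (12 * \<sigma>s)
     | _ \<Rightarrow> 0)"


section \<open>Genuine coupling\<close>

definition symbolA :: "('n::finite \<Rightarrow> real ^ 'm ^ 'm) \<Rightarrow> real ^ 'n \<Rightarrow> real ^ 'm ^ 'm" where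
  "symbolA A \<omega> = (\<Sum>j\<in>UNIV. \<omega> $ j *\<^sub>R A j)"

definition symbolB :: "('n::finite \<Rightarrow> 'n \<Rightarrow> real ^ 'm ^ 'm) \<Rightarrow> real ^ 'n \<Rightarrow> real ^ 'm ^ 'm" where
  "symbolB B \<omega> = (\<Sum>j\<in>UNIV. \<Sum>k\<in>UNIV. (\<omega> $ j * \<omega> $ k) *\<^sub>R B j k)"

text \<open>Genuine coupling of the constant-coefficient system
  \<open>A\<^sub>0 V\<^sub>t + \<Sum>\<^sub>j A j V\<^sub>x\<^sub>j + L V = \<Sum>\<^sub>j\<^sub>k B j k V\<^sub>x\<^sub>j\<^sub>x\<^sub>k\<close>, which is given by its coefficient
  matrices.\<close>

definition genuinely_coupled ::
  "real ^ 'm ^ 'm \<Rightarrow> ('n::finite \<Rightarrow> real ^ 'm ^ 'm) \<Rightarrow> real ^ 'm ^ 'm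
    \<Rightarrow> ('n \<Rightarrow> 'n \<Rightarrow> real ^ 'm ^ ('m::finite)) \<Rightarrow> bool" where
  "genuinely_coupled A0 A L B \<longleftrightarrow>
     (\<forall>\<omega>\<in>sphere 0 1. \<forall>\<psi>. \<psi> \<noteq> 0 \<and> symbolB B \<omega> *v \<psi> = 0 \<and> L *v \<psi> = 0 \<longrightarrow>
        (\<forall>\<mu>::real. \<mu> *\<^sub>R (A0 *v \<psi>) + symbolA A \<omega> *v \<psi> \<noteq> 0))"

end

theory Submission
  imports Defs
begin

text \<open>The obstruction is the shear wave. A pure velocity perturbation \<open>\<psi> = (0, v, 0, 0)\<close> is seen
  neither by the dissipation \<open>B\<close> nor by the relaxation \<open>L\<close>, both of which act on the temperature
  and radiation components only. It couples to density, temperature and radiation solely through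
  the divergence, whose symbol is \<open>\<omega> \<bullet> v\<close>. If \<open>v\<close> is orthogonal to the direction \<open>\<omega>\<close>, that coupling
  vanishes and the perturbation is merely transported by the background flow:
  \<open>A(\<omega>) \<psi> = (u \<bullet> \<omega>) A\<^sup>0 \<psi>\<close> (lemma \<open>symbolA_shear\<close>), so \<open>\<mu> = - (u \<bullet> \<omega>)\<close> violates the
  coupling condition. A nonzero such \<open>v\<close> exists as soon as the dimension is at least two.\<close>

definition shear :: "real ^ 'n::finite \<Rightarrow> real ^ ('n comp)" where
  "shear v = (\<chi> a. case a of Vel k \<Rightarrow> v $ k | _ \<Rightarrow> 0)"

lemma sum_comp:
  fixes f :: "'n::finite comp \<Rightarrow> real"
  shows "(\<Sum>a\<in>UNIV. f a) = f Rho + (\<Sum>k\<in>UNIV. f (Vel k)) + f Theta + f Eta"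
proof -
  have "(\<Sum>a\<in>range Vel. f a) = (\<Sum>k\<in>UNIV. f (Vel k))"
    by (subst sum.reindex) (auto simp: inj_on_def)
  then show ?thesis
    by (simp add: UNIV_comp image_iff)
qed

lemma shear_nth:
  "shear v $ Rho = 0" "shear v $ Vel k = v $ k" "shear v $ Theta = 0" "shear v $ Eta = 0"
  by (simp_all add: shear_def)

lemma matrix_vector_mult_shear:
  "(M *v shear v) $ a = (\<Sum>k\<in>UNIV. M $ a $ Vel k * v $ k)"
  by (simp add: matrix_vector_mult_def shear_nth sum_comp)

lemma shear_eq_0_iff: "shear v = 0 \<longleftrightarrow> v = 0"
proof
  assume "shear v = 0"
  then have "shear v $ Vel k = 0" for k
    by simp
  then show "v = 0"
    by (simp add: shear_def vec_eq_iff)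
qed (simp add: shear_def vec_eq_iff split: comp.split)

lemma matA0_shear: "matA0 p e \<rho> \<theta> \<eta> *v shear v = (\<rho> * \<theta> * \<eta>) *\<^sub>R shear v"
  (is "?l = ?r")
proof (rule vec_eq_iff[THEN iffD2], rule allI)
  fix a
  show "?l $ a = ?r $ a"
    by (cases a) (simp_all add: matrix_vector_mult_shear matA0_def shear_nth if_distrib if_distribR
        cong: if_cong)
qed

lemma matL_shear: "matL \<sigma>a \<theta> \<eta> *v shear v = 0"
  (is "?l = ?r")
proof (rule vec_eq_iff[THEN iffD2], rule allI)
  fix a
  show "?l $ a = ?r $ a"
    by (cases a) (simp_all add: matrix_vector_mult_shear matL_def)
qed

lemma symbolB_shear: "symbolB (matB \<sigma>s \<theta>) \<omega> *v shear v = 0"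
  (is "?l = ?r")
proof (rule vec_eq_iff[THEN iffD2], rule allI)
  fix a
  show "?l $ a = ?r $ a"
    by (cases a) (simp_all add: matrix_vector_mult_shear symbolB_def matB_def)
qed

text \<open>The first summand is transport by the background flow. The second is the effect of
  compression on the other components; its vector does not depend on \<open>j\<close>, so that summation
  against \<open>\<omega>\<close> leaves it with the single factor \<open>\<omega> \<bullet> v\<close>.\<close>

lemma matA_shear:
  "matA p e \<rho> u \<theta> \<eta> j *v shear v = (\<rho> * \<theta> * \<eta> * u $ j) *\<^sub>R shear v
     + v $ j *\<^sub>R (\<chi> a. case a of Rho \<Rightarrow> \<theta> * d_rho p (\<rho>, \<theta>) * \<eta> | Vel i \<Rightarrow> 0
                    | Theta \<Rightarrow> \<theta> * \<eta> * d_theta p (\<rho>, \<theta>) | Eta \<Rightarrow> 1 / 3 * \<theta> * \<eta>)"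
  (is "?l = ?r")
proof -
  have inner: "u \<bullet> axis j 1 = u $ j"
    by (simp add: inner_axis)
  have nth: "axis j 1 $ k = (if k = j then 1 else 0 :: real)" for k
    by (simp add: axis_def)
  show ?thesis
  proof (rule vec_eq_iff[THEN iffD2], rule allI)
    fix a
    show "?l $ a = ?r $ a"
      by (cases a) (simp_all add: matrix_vector_mult_shear matA_def shear_nth inner nth
          if_distrib if_distribR cong: if_cong)
  qed
qed

lemma symbolA_mult_vec: "symbolA A \<omega> *v x = (\<Sum>j\<in>UNIV. \<omega> $ j *\<^sub>R (A j *v x))"
proof -
  have "linear (\<lambda>M. M *v x)"
    by (simp add: linear_iff algebra_simps scaleR_matrix_vector_assoc)
  from linear_sum[OF this] show ?thesis
    by (simp add: symbolA_def scaleR_matrix_vector_assoc)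
qed

lemma symbolA_shear:
  fixes \<omega> :: "real ^ 'n::finite"
  assumes "\<omega> \<bullet> v = 0"
  shows "symbolA (matA p e \<rho> u \<theta> \<eta>) \<omega> *v shear v
           = (u \<bullet> \<omega>) *\<^sub>R (matA0 p e \<rho> \<theta> \<eta> *v shear v)"
proof -
  define g :: "real ^ ('n comp)" where
    "g = (\<chi> a. case a of Rho \<Rightarrow> \<theta> * d_rho p (\<rho>, \<theta>) * \<eta> | Vel i \<Rightarrow> 0
                | Theta \<Rightarrow> \<theta> * \<eta> * d_theta p (\<rho>, \<theta>) | Eta \<Rightarrow> 1 / 3 * \<theta> * \<eta>)"
  have "symbolA (matA p e \<rho> u \<theta> \<eta>) \<omega> *v shear v
          = (\<Sum>j\<in>UNIV. \<omega> $ j *\<^sub>R (matA p e \<rho> u \<theta> \<eta> j *v shear v))"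
    by (simp add: symbolA_mult_vec)
  also have "\<dots> = (\<Sum>j\<in>UNIV. (u $ j * \<omega> $ j) *\<^sub>R ((\<rho> * \<theta> * \<eta>) *\<^sub>R shear v) + (\<omega> $ j * v $ j) *\<^sub>R g)"
    by (simp add: matA_shear g_def[symmetric] scaleR_add_right mult_ac)
  also have "\<dots> = (u \<bullet> \<omega>) *\<^sub>R ((\<rho> * \<theta> * \<eta>) *\<^sub>R shear v) + (\<omega> \<bullet> v) *\<^sub>R g"
    by (simp only: sum.distrib scaleR_sum_left[symmetric] inner_vec_def inner_real_def)
  finally show ?thesis
    using assms by (simp add: matA0_shear)
qed

theorem propositionB1:
  fixes p e s :: "real \<times> real \<Rightarrow> real"
    and \<sigma>a \<sigma>s \<rho> \<theta> \<eta> :: real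
    and u :: "real ^ 'n"
  assumes "thermo_functions p e s"
    and "\<sigma>a > 0" and "\<sigma>s > 0"
    and "CARD('n) \<ge> 2"
    and "\<rho> > 0" and "\<theta> > 0" and "\<eta> > 0"
    and "\<eta> = \<theta> ^ 4"
  shows "\<not> genuinely_coupled (matA0 p e \<rho> \<theta> \<eta>) (matA p e \<rho> u \<theta> \<eta>) (matL \<sigma>a \<theta> \<eta>) (matB \<sigma>s \<theta>)
    \<and> (\<exists>\<omega>\<in>sphere (0 :: real ^ 'n) 1. \<exists>\<psi> :: real ^ ('n comp). \<exists>\<mu> :: real. \<psi> \<noteq> 0
          \<and> symbolB (matB \<sigma>s \<theta>) \<omega> *v \<psi> = 0 \<and> matL \<sigma>a \<theta> \<eta> *v \<psi> = 0
          \<and> \<mu> *\<^sub>R (matA0 p e \<rho> \<theta> \<eta> *v \<psi>) + symbolA (matA p e \<rho> u \<theta> \<eta>) \<omega> *v \<psi> = 0)"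
proof -
  have "\<exists>i k :: 'n. i \<noteq> k"
    using \<open>CARD('n) \<ge> 2\<close> by (metis One_nat_def card_2_iff' card_le_Suc0_iff_eq finite
        not_less_eq_eq numeral_2_eq_2 UNIV_I)
  then obtain i k :: 'n where "i \<noteq> k"
    by blast
  define \<omega> v :: "real ^ 'n" where "\<omega> = axis i 1" and "v = axis k 1"
  have \<omega>: "\<omega> \<in> sphere 0 1" and "v \<noteq> 0" and "\<omega> \<bullet> v = 0"
    using \<open>i \<noteq> k\<close> by (simp_all add: \<omega>_def v_def inner_axis_axis)
  have "shear v \<noteq> 0"
    using \<open>v \<noteq> 0\<close> by (simp add: shear_eq_0_iff)
  moreover have "- (u \<bullet> \<omega>) *\<^sub>R (matA0 p e \<rho> \<theta> \<eta> *v shear v)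
      + symbolA (matA p e \<rho> u \<theta> \<eta>) \<omega> *v shear v = 0"
    using symbolA_shear[OF \<open>\<omega> \<bullet> v = 0\<close>] by simp
  ultimately have *: "\<exists>\<omega>\<in>sphere (0 :: real ^ 'n) 1. \<exists>\<psi> :: real ^ ('n comp). \<exists>\<mu> :: real. \<psi> \<noteq> 0
      \<and> symbolB (matB \<sigma>s \<theta>) \<omega> *v \<psi> = 0 \<and> matL \<sigma>a \<theta> \<eta> *v \<psi> = 0
      \<and> \<mu> *\<^sub>R (matA0 p e \<rho> \<theta> \<eta> *v \<psi>) + symbolA (matA p e \<rho> u \<theta> \<eta>) \<omega> *v \<psi> = 0"
    using \<omega> symbolB_shear matL_shear by blast
  then show ?thesis
    unfolding genuinely_coupled_def by blast
qed

end
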